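(* Let $S$ be the unilateral shift on $H^2(\mathbb{D})$ and let $u,v$ be nonzero elements of $H^2(\mathbb{D})$ such that $v,S^*u$ are linearly dependent and the operator $T=S+u\otimes v$ is not an isometry. Then $T$ is quasinormal if and only if there exists $\alpha\in\mathbb{D}$ such that $v=(1-|\alpha|^2)\,v(\alpha)\,k_\alpha$ and $$1+\overline{v(\alpha)}\,(1-|\alpha|^2)\,(S^*u)(\alpha)=\bar\alpha\,\overline{v(\alpha)}\,u(0).$$
   Context: $H^2(\mathbb{D})$ is the Hardy space on the unit disc; $S$ is multiplication by $z$; $(u\otimes v)f=\langle f,v\rangle u$ (inner product linear in the first variable). For $\alpha\in\mathbb{D}$, $k_\alpha(z)=\frac{1}{1-\bar\alpha z}$ is the kernel function at $\alpha$. An operator $T$ is quasinormal if $T(T^*T)=(T^*T)T$. *)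

theory Defs
  imports "HOL-Complex_Analysis.Complex_Analysis"
begin

text \<open>
  The Hardy space consists of the holomorphic functions on the open unit disc whose Taylor
  coefficients at 0 are square summable, with the inner product of the coefficient sequences.
  An element is represented by the HOL function that vanishes off the disc, so that equality
  of HOL functions is equality of elements of the space.
\<close>

abbreviation taylor :: "(complex \<Rightarrow> complex) \<Rightarrow> nat \<Rightarrow> complex" where
  "taylor f n \<equiv> fps_nth (fps_expansion f 0) n"

definition H2 :: "(complex \<Rightarrow> complex) set" where
  "H2 = {f. f holomorphic_on ball 0 1 \<and> (\<forall>z. z \<notin> ball 0 1 \<longrightarrow> f z = 0) \<and>
            summable (\<lambda>n. (cmod (taylor f n))\<^sup>2)}"

definition H2_inner :: "(complex \<Rightarrow> complex) \<Rightarrow> (complex \<Rightarrow> complex) \<Rightarrow> complex" where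
  "H2_inner f g = (\<Sum>n. taylor f n * cnj (taylor g n))"

definition H2_norm :: "(complex \<Rightarrow> complex) \<Rightarrow> real" where
  "H2_norm f = sqrt (Re (H2_inner f f))"

text \<open>Operators are maps on functions, of which only the values on \<open>H2\<close> matter.\<close>

type_synonym H2_op = "(complex \<Rightarrow> complex) \<Rightarrow> (complex \<Rightarrow> complex)"

text \<open>
  By the Riesz theorem the description below determines a unique element whenever \<open>T\<close> is a
  bounded linear operator on \<open>H2\<close> and \<open>g \<in> H2\<close>; other arguments give an unspecified value.
\<close>

definition H2_adjoint :: "H2_op \<Rightarrow> H2_op" where
  "H2_adjoint T g = (THE h. h \<in> H2 \<and> (\<forall>f\<in>H2. H2_inner (T f) g = H2_inner f h))"

definition H2_isometry :: "H2_op \<Rightarrow> bool" where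
  "H2_isometry T \<longleftrightarrow> (\<forall>f\<in>H2. H2_norm (T f) = H2_norm f)"

definition quasinormal :: "H2_op \<Rightarrow> bool" where
  "quasinormal T \<longleftrightarrow> (\<forall>f\<in>H2. T (H2_adjoint T (T f)) = H2_adjoint T (T (T f)))"

definition shift :: H2_op where
  "shift f = (\<lambda>z. z * f z)"

definition rank_one :: "(complex \<Rightarrow> complex) \<Rightarrow> (complex \<Rightarrow> complex) \<Rightarrow> H2_op" where
  "rank_one u v f = (\<lambda>z. H2_inner f v * u z)"

definition kernel_fun :: "complex \<Rightarrow> complex \<Rightarrow> complex" where
  "kernel_fun \<alpha> z = (if z \<in> ball 0 1 then 1 / (1 - cnj \<alpha> * z) else 0)"

text \<open>
  Dependence of the pair \<open>(f, g)\<close> as a family: it also holds when \<open>f = g\<close>, unlike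
  dependence of the set \<open>{f, g}\<close>.
\<close>

definition lin_dep :: "(complex \<Rightarrow> complex) \<Rightarrow> (complex \<Rightarrow> complex) \<Rightarrow> bool" where
  "lin_dep f g \<longleftrightarrow> (\<exists>a b. (a \<noteq> 0 \<or> b \<noteq> 0) \<and> (\<forall>z. a * f z + b * g z = 0))"

end

theory Submission imports Defs begin

text \<open>
  Write \<open>S\<^sup>* u = \<kappa> v\<close>. Then \<open>T\<^sup>* T = I + c (v \<otimes> v)\<close> with a scalar \<open>c\<close>, which is nonzero since \<open>T\<close> is
  not an isometry, so \<open>T\<close> is quasinormal iff \<open>T v \<otimes> v = v \<otimes> T\<^sup>* v\<close>, i.e. iff \<open>T v = \<mu> v\<close> and
  \<open>T\<^sup>* v = cnj \<mu> v\<close> for some \<open>\<mu>\<close>. The second equation makes \<open>v\<close> an eigenvector of the backward shift,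
  that is, a multiple of a kernel function \<open>k\<^sub>\<alpha>\<close>; applying the backward shift to the first one
  and evaluating it at \<open>0\<close> then gives the scalar equation.
\<close>

section \<open>The Hardy space\<close>

lemma H2_holomorphic: "f \<in> H2 \<Longrightarrow> f holomorphic_on ball 0 1"
  by (simp add: H2_def)

lemma H2_outside: "f \<in> H2 \<Longrightarrow> z \<notin> ball 0 1 \<Longrightarrow> f z = 0"
  by (simp add: H2_def)

lemma H2_summable: "f \<in> H2 \<Longrightarrow> summable (\<lambda>n. (cmod (taylor f n))\<^sup>2)"
  by (simp add: H2_def)

lemma H2_has_fps_expansion: "f \<in> H2 \<Longrightarrow> f has_fps_expansion fps_expansion f 0"
  using has_fps_expansion_fps_expansion[of "ball 0 1" f] by (auto dest: H2_holomorphic)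

lemma H2_conv_radius: "f \<in> H2 \<Longrightarrow> fps_conv_radius (fps_expansion f 0) \<ge> 1"
  by (rule holomorphic_on_imp_fps_conv_radius_ge[OF H2_has_fps_expansion])
    (auto dest: H2_holomorphic simp: one_ereal_def)

lemma H2_sums:
  assumes "f \<in> H2" "z \<in> ball 0 1"
  shows "(\<lambda>n. taylor f n * z ^ n) sums f z"
  using has_fps_expansion_imp_sums_complex[OF H2_has_fps_expansion[OF assms(1)], of 1 z]
    assms H2_holomorphic[OF assms(1)] by (simp add: one_ereal_def)

lemma H2_taylor_0: "f \<in> H2 \<Longrightarrow> taylor f 0 = f 0"
  using H2_sums[of f 0] sums_unique2 powser_sums_zero by fastforce

lemma H2_eqI:
  assumes "f \<in> H2" "g \<in> H2" "\<And>n. taylor f n = taylor g n"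
  shows "f = g"
proof
  fix z show "f z = g z"
    using H2_sums[OF assms(1), of z] H2_sums[OF assms(2), of z] H2_outside[OF assms(1), of z]
      H2_outside[OF assms(2), of z] assms(3) by (cases "z \<in> ball 0 1") (auto dest: sums_unique2)
qed

section \<open>Linear structure of the space\<close>

lemma summable_square_add:
  fixes a b :: "nat \<Rightarrow> complex"
  assumes "summable (\<lambda>n. (cmod (a n))\<^sup>2)" "summable (\<lambda>n. (cmod (b n))\<^sup>2)"
  shows "summable (\<lambda>n. (cmod (a n + b n))\<^sup>2)"
proof (rule summable_comparison_test')
  show "summable (\<lambda>n. 2 * (cmod (a n))\<^sup>2 + 2 * (cmod (b n))\<^sup>2)"
    using assms by (intro summable_add summable_mult)
  fix n
  have "(cmod (a n + b n))\<^sup>2 \<le> (cmod (a n) + cmod (b n))\<^sup>2"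
    by (intro power_mono norm_triangle_ineq) auto
  also have "\<dots> \<le> 2 * (cmod (a n))\<^sup>2 + 2 * (cmod (b n))\<^sup>2"
    using sum_squares_bound[of "cmod (a n)" "cmod (b n)"] by (simp add: power2_sum)
  finally show "norm ((cmod (a n + b n))\<^sup>2) \<le> 2 * (cmod (a n))\<^sup>2 + 2 * (cmod (b n))\<^sup>2"
    by simp
qed

lemma taylor_add_scale:
  assumes "f \<in> H2" "g \<in> H2"
  shows "taylor (\<lambda>z. f z + c * g z) n = taylor f n + c * taylor g n"
proof -
  have "(\<lambda>z. f z + c * g z) has_fps_expansion fps_expansion f 0 + fps_const c * fps_expansion g 0"
    using assms by (intro fps_expansion_intros H2_has_fps_expansion)
  from fps_expansion_eqI[OF this] show ?thesis by simp
qed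

lemma H2_add_scale:
  assumes "f \<in> H2" "g \<in> H2"
  shows "(\<lambda>z. f z + c * g z) \<in> H2"
proof -
  have "summable (\<lambda>n. (cmod (c * taylor g n))\<^sup>2)"
    using H2_summable[OF assms(2)] by (simp add: norm_mult power_mult_distrib summable_mult)
  from summable_square_add[OF H2_summable[OF assms(1)] this] show ?thesis
    using assms H2_holomorphic[OF assms(1)] H2_holomorphic[OF assms(2)]
    by (auto simp: H2_def taylor_add_scale intro!: holomorphic_intros)
qed

lemma taylor_zero: "taylor (\<lambda>_. 0) n = 0"
  by (simp add: fps_expansion_eqI[OF has_fps_expansion_0])

lemma H2_zero: "(\<lambda>_. 0) \<in> H2"
  by (simp add: H2_def taylor_zero)

lemma taylor_scale: "g \<in> H2 \<Longrightarrow> taylor (\<lambda>z. c * g z) n = c * taylor g n"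
  using taylor_add_scale[OF H2_zero, of g c n] by (simp add: taylor_zero)

lemma H2_scale: "g \<in> H2 \<Longrightarrow> (\<lambda>z. c * g z) \<in> H2"
  using H2_add_scale[OF H2_zero, of g c] by simp

section \<open>The inner product and uniqueness of adjoints\<close>

lemma summable_inner:
  assumes "f \<in> H2" "g \<in> H2"
  shows "summable (\<lambda>n. taylor f n * cnj (taylor g n))"
proof (rule summable_comparison_test')
  show "summable (\<lambda>n. (cmod (taylor f n))\<^sup>2 + (cmod (taylor g n))\<^sup>2)"
    using assms by (intro summable_add H2_summable)
  fix n
  show "norm (taylor f n * cnj (taylor g n)) \<le> (cmod (taylor f n))\<^sup>2 + (cmod (taylor g n))\<^sup>2"
    \<comment> \<open>\<open>2xy \<le> x\<^sup>2 + y\<^sup>2\<close> for the two moduli, and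
      \<open>xy \<ge> 0\<close> allows the factor 2 to be dropped.\<close>
    using sum_squares_bound[of "cmod (taylor f n)" "cmod (taylor g n)"]
      mult_nonneg_nonneg[OF norm_ge_zero[of "taylor f n"] norm_ge_zero[of "taylor g n"]]
    unfolding norm_mult complex_mod_cnj mult.assoc by linarith
qed

lemma inner_add_scale_left:
  assumes "f \<in> H2" "g \<in> H2" "h \<in> H2"
  shows "H2_inner (\<lambda>z. f z + c * g z) h = H2_inner f h + c * H2_inner g h"
  using assms suminf_add[OF summable_inner[OF assms(1,3)] summable_mult[OF summable_inner[OF assms(2,3)]], of c]
    suminf_mult[OF summable_inner[OF assms(2,3)], of c]
  by (simp add: H2_inner_def taylor_add_scale algebra_simps)

lemma inner_cnj:
  assumes "f \<in> H2" "g \<in> H2"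
  shows "H2_inner g f = cnj (H2_inner f g)"
proof -
  have "(\<lambda>n. cnj (taylor f n * cnj (taylor g n))) sums cnj (H2_inner f g)"
    unfolding sums_cnj H2_inner_def using summable_inner[OF assms] by (rule summable_sums)
  from sums_unique[OF this] show ?thesis by (simp add: H2_inner_def mult.commute)
qed

lemma inner_add_scale_right:
  assumes "f \<in> H2" "g \<in> H2" "h \<in> H2"
  shows "H2_inner h (\<lambda>z. f z + c * g z) = H2_inner h f + cnj c * H2_inner h g"
  using inner_add_scale_left[OF assms, of c] inner_cnj[of _ h] assms H2_add_scale[of f g c]
  by (metis complex_cnj_add complex_cnj_mult inner_cnj)

lemma inner_scale_right:
  assumes "g \<in> H2" "h \<in> H2"
  shows "H2_inner h (\<lambda>z. c * g z) = cnj c * H2_inner h g"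
  \<comment> \<open>The second instance reads \<open>x = x + x\<close> for the inner product
    \<open>x\<close> of \<open>h\<close> with the zero function, so \<open>x = 0\<close>.\<close>
  using inner_add_scale_right[OF H2_zero assms, of c] inner_add_scale_right[OF H2_zero H2_zero assms(2), of 1]
  by simp

lemma inner_self_eq_0:
  assumes "f \<in> H2" "H2_inner f f = 0"
  shows "f = (\<lambda>_. 0)"
proof -
  \<comment> \<open>The complex series defining \<open>H2_inner f f\<close> is identified with a
    real series of nonnegative terms, which vanishes only if every term does.\<close>
  have "(\<lambda>n. of_real ((cmod (taylor f n))\<^sup>2)) sums (of_real (\<Sum>n. (cmod (taylor f n))\<^sup>2) :: complex)"
    unfolding sums_of_real_iff using H2_summable[OF assms(1)] by (rule summable_sums)
  from sums_unique[OF this] have "(\<Sum>n. (cmod (taylor f n))\<^sup>2) = 0"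
    using assms(2) by (simp add: H2_inner_def flip: complex_norm_square)
  hence "taylor f n = 0" for n
    using suminf_eq_zero_iff[OF H2_summable[OF assms(1)]] by simp
  thus ?thesis
    using assms(1) by (intro H2_eqI[OF _ H2_zero]) (simp_all add: taylor_zero)
qed

text \<open>Testing against \<open>f = g - h\<close> shows that the difference has norm
  zero.\<close>

lemma H2_eqI_inner:
  assumes "g \<in> H2" "h \<in> H2" "\<And>f. f \<in> H2 \<Longrightarrow> H2_inner f g = H2_inner f h"
  shows "g = h"
proof -
  let ?d = "\<lambda>z. g z + (- 1) * h z"
  have d: "?d \<in> H2" using assms by (intro H2_add_scale)
  have "H2_inner ?d ?d = 0"
    using inner_add_scale_right[OF assms(1,2) d, of "-1"] assms(3)[OF d] by simp
  from inner_self_eq_0[OF d this] show ?thesis by (simp add: fun_eq_iff)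
qed

text \<open>Uniqueness of the representing element is all that the definite description requires
  once a candidate is given explicitly; each adjoint below is obtained in this way.\<close>

lemma adjoint_eqI:
  assumes "h \<in> H2" "\<And>f. f \<in> H2 \<Longrightarrow> H2_inner (T f) g = H2_inner f h"
  shows "H2_adjoint T g = h"
  unfolding H2_adjoint_def using assms by (intro the_equality) (auto intro: H2_eqI_inner)

section \<open>The shift and its adjoint\<close>

text \<open>This is \<open>(f z - f 0) / z\<close>. Evaluating the shifted power series avoids the
  removable singularity at 0.\<close>

definition backward_shift :: H2_op where
  "backward_shift f =
    (\<lambda>z. if z \<in> ball 0 1 then eval_fps (fps_shift 1 (fps_expansion f 0)) z else 0)"

lemma taylor_backward_shift:
  assumes "f \<in> H2"
  shows "taylor (backward_shift f) n = taylor f (Suc n)"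
proof -
  let ?F = "fps_shift 1 (fps_expansion f 0)"
  have "fps_conv_radius ?F > 0"
    using H2_conv_radius[OF assms] less_le_trans[of 0 "1 :: ereal"] by (simp add: fps_conv_radius_shift)
  hence "eval_fps ?F has_fps_expansion ?F" by (rule eval_fps_has_fps_expansion)
  \<comment> \<open>The two functions may differ off the disc, but Taylor coefficients at 0 depend
    only on a neighbourhood of 0.\<close>
  moreover have "eventually (\<lambda>z. eval_fps ?F z = backward_shift f z) (nhds 0)"
    by (rule eventually_mono[OF eventually_nhds_in_open[of "ball 0 1"]]) (auto simp: backward_shift_def)
  ultimately have "backward_shift f has_fps_expansion ?F"
    using has_fps_expansion_cong by blast
  from fps_expansion_eqI[OF this] show ?thesis by simp
qed

lemma H2_backward_shift:
  assumes "f \<in> H2"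
  shows "backward_shift f \<in> H2"
proof -
  have "eval_fps (fps_shift 1 (fps_expansion f 0)) holomorphic_on ball 0 1"
  proof (intro holomorphic_on_eval_fps subsetI)
    fix z :: complex assume "z \<in> ball 0 1"
    hence "ereal (norm z) < 1" by (simp add: one_ereal_def)
    also note H2_conv_radius[OF assms]
    finally show "z \<in> eball 0 (fps_conv_radius (fps_shift 1 (fps_expansion f 0)))"
      by (simp add: in_eball_iff)
  qed
  hence "backward_shift f holomorphic_on ball 0 1"
    by (rule holomorphic_transform) (auto simp: backward_shift_def)
  moreover have "summable (\<lambda>n. (cmod (taylor f (Suc n)))\<^sup>2)"
    using H2_summable[OF assms] summable_Suc_iff[of "\<lambda>n. (cmod (taylor f n))\<^sup>2"] by blast
  ultimately show ?thesis
    using taylor_backward_shift[OF assms] by (simp add: H2_def) (simp add: backward_shift_def)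
qed

lemma backward_shift_decomp:
  assumes "f \<in> H2" "z \<in> ball 0 1"
  shows "f z = f 0 + z * backward_shift f z"
proof -
  have "(\<lambda>n. z * (taylor (backward_shift f) n * z ^ n)) sums (z * backward_shift f z)"
    using H2_sums[OF H2_backward_shift] assms by (intro sums_mult)
  hence "(\<lambda>n. taylor f (Suc n) * z ^ Suc n) sums (z * backward_shift f z)"
    using taylor_backward_shift[OF assms(1)] by (simp add: algebra_simps)
  from sums_Suc[OF this] H2_sums[OF assms] show ?thesis
    using H2_taylor_0[OF assms(1)] by (auto simp: add.commute dest: sums_unique2)
qed

lemma taylor_shift:
  assumes "f \<in> H2"
  shows "taylor (shift f) n = (case n of 0 \<Rightarrow> 0 | Suc m \<Rightarrow> taylor f m)"
proof -
  have "shift f has_fps_expansion fps_X * fps_expansion f 0"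
    unfolding shift_def using assms by (intro fps_expansion_intros H2_has_fps_expansion)
  from fps_expansion_eqI[OF this] show ?thesis by (simp split: nat.split)
qed

lemma H2_shift:
  assumes "f \<in> H2"
  shows "shift f \<in> H2"
proof -
  have "summable (\<lambda>n. (cmod (taylor (shift f) (Suc n)))\<^sup>2)"
    using H2_summable[OF assms] taylor_shift[OF assms] by simp
  hence "summable (\<lambda>n. (cmod (taylor (shift f) n))\<^sup>2)"
    using summable_Suc_iff[of "\<lambda>n. (cmod (taylor (shift f) n))\<^sup>2"] by blast
  thus ?thesis
    using H2_holomorphic[OF assms] H2_outside[OF assms]
    by (auto simp: H2_def shift_def intro!: holomorphic_intros)
qed

lemma backward_shift_shift: "f \<in> H2 \<Longrightarrow> backward_shift (shift f) = f"
  by (rule H2_eqI) (simp_all add: H2_backward_shift H2_shift taylor_backward_shift taylor_shift)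

lemma backward_shift_add_scale:
  assumes "f \<in> H2" "g \<in> H2"
  shows "backward_shift (\<lambda>z. f z + c * g z) = (\<lambda>z. backward_shift f z + c * backward_shift g z)"
  using assms
  by (intro H2_eqI) (simp_all add: H2_backward_shift H2_add_scale taylor_backward_shift taylor_add_scale)

lemma backward_shift_scale:
  "g \<in> H2 \<Longrightarrow> backward_shift (\<lambda>z. c * g z) = (\<lambda>z. c * backward_shift g z)"
  by (intro H2_eqI) (simp_all add: H2_backward_shift H2_scale taylor_backward_shift taylor_scale)

text \<open>The constant coefficient of \<open>shift f\<close> is 0, so the series loses its first
  term and can be reindexed.\<close>

lemma inner_shift:
  assumes "f \<in> H2" "g \<in> H2"
  shows "H2_inner (shift f) g = H2_inner f (backward_shift g)"
  using suminf_split_head[OF summable_inner[OF H2_shift[OF assms(1)] assms(2)]] assms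
  by (simp add: H2_inner_def taylor_shift taylor_backward_shift)

lemma adjoint_shift: "g \<in> H2 \<Longrightarrow> H2_adjoint shift g = backward_shift g"
  by (intro adjoint_eqI H2_backward_shift inner_shift)

section \<open>Eigenvectors of the backward shift\<close>

text \<open>The eigenvalue equation is a recursion that makes the Taylor coefficients geometric with
  ratio \<open>cnj \<alpha>\<close>. Square summability then forces \<open>\<alpha>\<close> into the
  disc, and summing the series gives the kernel function.\<close>

lemma backward_shift_eigenvector:
  assumes "v \<in> H2" "v \<noteq> (\<lambda>_. 0)" and eig: "backward_shift v = (\<lambda>z. cnj \<alpha> * v z)"
  shows "\<alpha> \<in> ball 0 1" "v = (\<lambda>z. v 0 * kernel_fun \<alpha> z)"
proof -
  have "taylor (backward_shift v) n = cnj \<alpha> * taylor v n" for n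
    using taylor_scale[OF assms(1)] by (simp add: eig)
  hence step: "taylor v (Suc n) = cnj \<alpha> * taylor v n" for n
    using taylor_backward_shift[OF assms(1)] by simp
  have tay: "taylor v n = v 0 * cnj \<alpha> ^ n" for n
    by (induction n) (use step H2_taylor_0[OF assms(1)] in simp_all)
  have v0: "v 0 \<noteq> 0"
  proof
    assume "v 0 = 0"
    hence "v = (\<lambda>_. 0)"
      using tay assms(1) by (intro H2_eqI[OF _ H2_zero]) (simp_all add: taylor_zero)
    with assms(2) show False by simp
  qed
  have "(\<lambda>n. (cmod (taylor v n))\<^sup>2) = (\<lambda>n. (cmod (v 0))\<^sup>2 * ((cmod \<alpha>)\<^sup>2) ^ n)"
    by (simp only: tay) (simp add: norm_mult norm_power power_mult_distrib mult.commute flip: power_mult)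
  \<comment> \<open>Since \<open>v 0\<close> is nonzero, its factor can be cancelled, leaving a
    plain geometric series.\<close>
  hence "summable (\<lambda>n. ((cmod \<alpha>)\<^sup>2) ^ n)"
    using H2_summable[OF assms(1)] v0 by (simp add: summable_cmult_iff)
  thus \<alpha>: "\<alpha> \<in> ball 0 1"
    by (simp add: summable_geometric_iff power_less_one_iff)
  show "v = (\<lambda>z. v 0 * kernel_fun \<alpha> z)"
  proof
    fix z show "v z = v 0 * kernel_fun \<alpha> z"
    proof (cases "z \<in> ball 0 1")
      case True
      hence "cmod (cnj \<alpha> * z) < 1"
        using \<alpha> mult_strict_mono'[of "cmod \<alpha>" 1 "cmod z" 1] by (simp add: norm_mult)
      from sums_mult[OF geometric_sums[OF this], of "v 0"]
      have "(\<lambda>n. taylor v n * z ^ n) sums (v 0 * (1 / (1 - cnj \<alpha> * z)))"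
        by (simp only: tay) (simp add: power_mult_distrib mult.assoc)
      with H2_sums[OF assms(1) True] True show ?thesis
        by (auto simp: kernel_fun_def dest: sums_unique2)
    qed (use H2_outside[OF assms(1)] in \<open>auto simp: kernel_fun_def\<close>)
  qed
qed

lemma taylor_kernel_fun:
  assumes "v \<in> H2" "\<alpha> \<in> ball 0 1" and v: "v = (\<lambda>z. c * kernel_fun \<alpha> z)"
  shows "taylor v n = c * cnj \<alpha> ^ n"
proof -
  have "eventually (\<lambda>z. (\<lambda>n. fps_nth (Abs_fps (\<lambda>n. c * cnj \<alpha> ^ n)) n * z ^ n) sums v z) (nhds 0)"
  proof (rule eventually_mono[OF eventually_nhds_in_open[of "ball 0 1"]])
    fix z :: complex assume z: "z \<in> ball 0 1"
    hence "cmod (cnj \<alpha> * z) < 1"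
      using assms(2) mult_strict_mono'[of "cmod \<alpha>" 1 "cmod z" 1] by (simp add: norm_mult)
    from sums_mult[OF geometric_sums[OF this], of c] show "(\<lambda>n. fps_nth (Abs_fps (\<lambda>n. c * cnj \<alpha> ^ n)) n * z ^ n) sums v z"
      using z by (simp add: v kernel_fun_def power_mult_distrib mult.assoc)
  qed simp_all
  hence "v has_fps_expansion Abs_fps (\<lambda>n. c * cnj \<alpha> ^ n)" by (intro has_fps_expansionI)
  from fps_expansion_eqI[OF this] show ?thesis by simp
qed

lemma backward_shift_kernel_fun:
  assumes "v \<in> H2" "\<alpha> \<in> ball 0 1" "v = (\<lambda>z. c * kernel_fun \<alpha> z)"
  shows "backward_shift v = (\<lambda>z. cnj \<alpha> * v z)"
proof (rule H2_eqI)
  show "taylor (backward_shift v) n = taylor (\<lambda>z. cnj \<alpha> * v z) n" for n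
    using taylor_scale[OF assms(1)] taylor_kernel_fun[OF assms] taylor_backward_shift[OF assms(1)] by simp
qed (use assms in \<open>auto intro: H2_backward_shift H2_scale\<close>)

text \<open>The reproducing property: pairing with the coefficients
  \<open>c * cnj \<alpha> ^ n\<close> sums the Taylor series of \<open>f\<close> at
  \<open>\<alpha>\<close>.\<close>

lemma inner_kernel_fun:
  assumes "f \<in> H2" "v \<in> H2" "\<alpha> \<in> ball 0 1" "v = (\<lambda>z. c * kernel_fun \<alpha> z)"
  shows "H2_inner f v = cnj c * f \<alpha>"
proof -
  from sums_mult[OF H2_sums[OF assms(1,3)], of "cnj c"]
  have "(\<lambda>n. taylor f n * cnj (taylor v n)) sums (cnj c * f \<alpha>)"
    using taylor_kernel_fun[OF assms(2-4)] by (simp add: algebra_simps)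
  from sums_unique[OF this] show ?thesis by (simp add: H2_inner_def)
qed

section \<open>Rank one perturbations of the shift\<close>

locale rank_one_perturbation =
  fixes u v :: "complex \<Rightarrow> complex" and T :: H2_op
  assumes u: "u \<in> H2" and v: "v \<in> H2" and v_nonzero: "v \<noteq> (\<lambda>_. 0)"
    and T: "T = (\<lambda>f z. shift f z + rank_one u v f z)"
begin

lemma T_eq: "T f = (\<lambda>z. shift f z + H2_inner f v * u z)"
  by (simp add: T rank_one_def)

lemma T_H2: "f \<in> H2 \<Longrightarrow> T f \<in> H2"
  unfolding T_eq by (intro H2_add_scale H2_shift u)

lemma T_add_scale:
  assumes "f \<in> H2" "g \<in> H2"
  shows "T (\<lambda>z. f z + c * g z) = (\<lambda>z. T f z + c * T g z)"
  using inner_add_scale_left[OF assms v] by (simp add: T_eq shift_def algebra_simps)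

text \<open>The explicit adjoint of \<open>T\<close>, using that the adjoint of
  \<open>rank_one u v\<close> is \<open>rank_one v u\<close>.\<close>

definition Tadj :: H2_op where
  "Tadj g = (\<lambda>z. backward_shift g z + H2_inner g u * v z)"

lemma Tadj_H2: "g \<in> H2 \<Longrightarrow> Tadj g \<in> H2"
  unfolding Tadj_def by (intro H2_add_scale H2_backward_shift v)

lemma inner_T:
  assumes "f \<in> H2" "g \<in> H2"
  shows "H2_inner (T f) g = H2_inner f (Tadj g)"
  using assms u v inner_cnj[OF u assms(2)]
  by (simp add: T_eq Tadj_def inner_add_scale_left inner_add_scale_right H2_shift H2_backward_shift inner_shift)

lemma adjoint_T: "g \<in> H2 \<Longrightarrow> H2_adjoint T g = Tadj g"
  by (intro adjoint_eqI Tadj_H2 inner_T)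

lemma inner_v_nonzero: "H2_inner v v \<noteq> 0"
  using inner_self_eq_0[OF v] v_nonzero by blast

end

section \<open>Quasinormality when the backward shift of \<open>u\<close> is a multiple of
  \<open>v\<close>\<close>

locale dependent_rank_one_perturbation = rank_one_perturbation +
  fixes \<kappa> :: complex
  assumes backward_u: "backward_shift u = (\<lambda>z. \<kappa> * v z)"
begin

text \<open>The scalar \<open>c\<close> in \<open>T\<^sup>* T = I + c (v \<otimes> v)\<close>. The
  last summand is the squared norm of \<open>u\<close>, left conjugated as it comes out of the
  second argument of the inner product.\<close>

definition defect :: complex where "defect = \<kappa> + cnj \<kappa> + cnj (H2_inner u u)"

text \<open>\<open>S\<^sup>* S = I\<close> produces the identity. The remaining terms are multiples
  of \<open>v\<close>, because both \<open>S\<^sup>* u\<close> and \<open>T\<^sup>* u\<close>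
  are.\<close>

lemma Tadj_T:
  assumes f: "f \<in> H2"
  shows "Tadj (T f) = (\<lambda>z. f z + defect * H2_inner f v * v z)"
proof -
  have "H2_inner (T f) u = H2_inner f (\<lambda>z. \<kappa> * v z + H2_inner u u * v z)"
    using inner_T[OF f u] by (simp add: Tadj_def backward_u)
  also have "\<dots> = (cnj \<kappa> + cnj (H2_inner u u)) * H2_inner f v"
    using inner_scale_right[OF v f, of "\<kappa> + H2_inner u u"] by (simp add: algebra_simps)
  finally have "H2_inner (T f) u = (cnj \<kappa> + cnj (H2_inner u u)) * H2_inner f v" .
  moreover have "backward_shift (T f) = (\<lambda>z. f z + H2_inner f v * (\<kappa> * v z))"
    unfolding T_eq using f u by (simp add: backward_shift_add_scale H2_shift backward_shift_shift backward_u)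
  ultimately show ?thesis by (simp add: Tadj_def defect_def algebra_simps)
qed

text \<open>Here \<open>T\<^sup>* T = I\<close>, and moving \<open>T\<close> across the inner
  product gives equality of norms.\<close>

lemma isometry_if_defect_0: "defect = 0 \<Longrightarrow> H2_isometry T"
  by (simp add: H2_isometry_def H2_norm_def inner_T T_H2 Tadj_T)

text \<open>Both products \<open>T T\<^sup>* T f\<close> and \<open>T\<^sup>* T T f\<close> are
  \<open>T f\<close> plus \<open>defect\<close> times a rank one term; cancelling \<open>T f\<close>
  and the nonzero \<open>defect\<close> leaves the comparison of these terms.\<close>

lemma quasinormal_iff_rank_one:
  assumes "defect \<noteq> 0"
  shows "quasinormal T \<longleftrightarrow> (\<forall>f\<in>H2. \<forall>z. H2_inner f v * T v z = H2_inner (T f) v * v z)"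
proof -
  have "T (H2_adjoint T (T f)) = H2_adjoint T (T (T f)) \<longleftrightarrow>
      (\<forall>z. H2_inner f v * T v z = H2_inner (T f) v * v z)" if f: "f \<in> H2" for f
  proof -
    have "T (H2_adjoint T (T f)) = (\<lambda>z. T f z + defect * H2_inner f v * T v z)"
      using f v by (simp add: adjoint_T T_H2 Tadj_T T_add_scale)
    moreover have "H2_adjoint T (T (T f)) = (\<lambda>z. T f z + defect * H2_inner (T f) v * v z)"
      using f by (simp add: adjoint_T T_H2 Tadj_T)
    ultimately show ?thesis using assms by (simp add: fun_eq_iff)
  qed
  thus ?thesis by (simp add: quasinormal_def)
qed

lemma quasinormal_iff_eigenvector:
  assumes "defect \<noteq> 0"
  shows "quasinormal T \<longleftrightarrow> (\<exists>\<mu>. T v = (\<lambda>z. \<mu> * v z) \<and> Tadj v = (\<lambda>z. cnj \<mu> * v z))"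
  unfolding quasinormal_iff_rank_one[OF assms]
proof
  assume comm: "\<forall>f\<in>H2. \<forall>z. H2_inner f v * T v z = H2_inner (T f) v * v z"
  \<comment> \<open>The value forced by taking \<open>f = v\<close> in the commutation
    relation.\<close>
  define \<mu> where "\<mu> = H2_inner (T v) v / H2_inner v v"
  have Tv: "T v z = \<mu> * v z" for z
    using comm v inner_v_nonzero by (simp add: \<mu>_def field_simps)
  \<comment> \<open>At a point where \<open>v\<close> does not vanish, the relation between
    functions becomes one between scalars.\<close>
  obtain w where w: "v w \<noteq> 0" using v_nonzero by auto
  have "Tadj v = (\<lambda>z. cnj \<mu> * v z)"
  proof (rule H2_eqI_inner)
    fix f assume f: "f \<in> H2"
    have "H2_inner f v * (\<mu> * v w) = H2_inner (T f) v * v w" using comm f Tv by auto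
    hence "H2_inner (T f) v = \<mu> * H2_inner f v" using w by (auto simp: mult.commute)
    thus "H2_inner f (Tadj v) = H2_inner f (\<lambda>z. cnj \<mu> * v z)"
      using f v by (simp add: inner_T inner_scale_right)
  qed (use v in \<open>auto intro: Tadj_H2 H2_scale\<close>)
  with Tv show "\<exists>\<mu>. T v = (\<lambda>z. \<mu> * v z) \<and> Tadj v = (\<lambda>z. cnj \<mu> * v z)" by auto
next
  assume "\<exists>\<mu>. T v = (\<lambda>z. \<mu> * v z) \<and> Tadj v = (\<lambda>z. cnj \<mu> * v z)"
  thus "\<forall>f\<in>H2. \<forall>z. H2_inner f v * T v z = H2_inner (T f) v * v z"
    using v by (auto simp: inner_T inner_scale_right)
qed

lemma kernel_if_eigenvector:
  assumes Tv: "T v = (\<lambda>z. \<mu> * v z)" and adj: "Tadj v = (\<lambda>z. cnj \<mu> * v z)"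
  obtains \<alpha> where "\<alpha> \<in> ball 0 1" "v = (\<lambda>z. (1 - (cmod \<alpha>)\<^sup>2) * v \<alpha> * kernel_fun \<alpha> z)"
    "1 + cnj (v \<alpha>) * (1 - (cmod \<alpha>)\<^sup>2) * backward_shift u \<alpha> = cnj \<alpha> * cnj (v \<alpha>) * u 0"
proof -
  \<comment> \<open>\<open>Tadj v\<close> is the backward shift of \<open>v\<close> plus
    \<open>H2_inner v u\<close> times \<open>v\<close>, so subtracting this scalar from
    \<open>cnj \<mu>\<close> gives the eigenvalue \<open>cnj \<alpha>\<close> of the backward
    shift.\<close>
  define \<alpha> where "\<alpha> = cnj (cnj \<mu> - H2_inner v u)"
  have eig: "backward_shift v = (\<lambda>z. cnj \<alpha> * v z)"
    using adj by (simp add: Tadj_def \<alpha>_def fun_eq_iff algebra_simps)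
  note ker = backward_shift_eigenvector[OF v v_nonzero eig]
  define r where "r = complex_of_real (1 - (cmod \<alpha>)\<^sup>2)"
  have r: "r = 1 - \<alpha> * cnj \<alpha>" "cnj r = r"
    by (simp_all add: r_def flip: complex_norm_square)
  have "complex_of_real ((cmod \<alpha>)\<^sup>2) \<noteq> 1"
    unfolding of_real_eq_1_iff using ker(1) power_less_one_iff[of "cmod \<alpha>" 2] by auto
  hence r_nonzero: "r \<noteq> 0" by (simp add: r_def)
  \<comment> \<open>The kernel function at \<open>\<alpha>\<close> takes the value
    \<open>1 / r\<close> at \<open>\<alpha>\<close> itself.\<close>
  have "v \<alpha> = v 0 / r"
    using fun_cong[OF ker(2), of \<alpha>] ker(1) by (simp add: kernel_fun_def r(1) mult.commute)
  hence v0: "v 0 = r * v \<alpha>" using r_nonzero by simp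
  have v0_nonzero: "v 0 \<noteq> 0"
  proof
    assume "v 0 = 0"
    hence "v z = 0" for z using fun_cong[OF ker(2), of z] by (metis mult_zero_left)
    with v_nonzero show False by auto
  qed
  have vv: "H2_inner v v = r * cnj (v \<alpha>) * v \<alpha>"
    using inner_kernel_fun[OF v v ker] v0 r(2) by simp
  \<comment> \<open>The backward shift of \<open>T v\<close> is computed from the definition of
    \<open>T\<close> and from \<open>T v = \<mu> v\<close>; comparison at 0, where \<open>v\<close>
    is nonzero, yields a scalar identity.\<close>
  have "backward_shift (T v) = (\<lambda>z. v z + H2_inner v v * (\<kappa> * v z))"
    unfolding T_eq using u v by (simp add: backward_shift_add_scale H2_shift backward_shift_shift backward_u)
  moreover have "backward_shift (T v) = (\<lambda>z. \<mu> * (cnj \<alpha> * v z))"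
    by (simp add: Tv backward_shift_scale[OF v] eig)
  ultimately have "v 0 + H2_inner v v * (\<kappa> * v 0) = \<mu> * (cnj \<alpha> * v 0)" by (simp add: fun_eq_iff)
  hence 1: "1 + H2_inner v v * \<kappa> = \<mu> * cnj \<alpha>" using v0_nonzero by algebra
  \<comment> \<open>At 0 the shift term of \<open>T v\<close> vanishes. As
    \<open>H2_inner v v\<close> equals \<open>cnj (v \<alpha>) * v 0\<close>, cancelling
    \<open>v 0\<close> determines \<open>\<mu>\<close>.\<close>
  have "H2_inner v v * u 0 = \<mu> * v 0" using fun_cong[OF Tv, of 0] by (simp add: T_eq shift_def)
  hence 2: "\<mu> = cnj (v \<alpha>) * u 0"
    using v0_nonzero unfolding vv v0 by (simp add: mult.assoc)
  show thesis
  proof (rule that)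
    show "v = (\<lambda>z. (1 - (cmod \<alpha>)\<^sup>2) * v \<alpha> * kernel_fun \<alpha> z)" using ker(2) unfolding v0 r_def .
    show "1 + cnj (v \<alpha>) * (1 - (cmod \<alpha>)\<^sup>2) * backward_shift u \<alpha> = cnj \<alpha> * cnj (v \<alpha>) * u 0"
      using 1 unfolding 2 vv backward_u r_def by (simp add: algebra_simps)
  qed (rule ker(1))
qed

text \<open>The choice of \<open>\<mu>\<close> is dictated by evaluating
  \<open>T v = \<mu> v\<close> at 0. The scalar condition then supplies both eigenvector
  equations.\<close>

lemma eigenvector_if_kernel:
  assumes \<alpha>: "\<alpha> \<in> ball 0 1" and ker: "v = (\<lambda>z. (1 - (cmod \<alpha>)\<^sup>2) * v \<alpha> * kernel_fun \<alpha> z)"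
    and cond: "1 + cnj (v \<alpha>) * (1 - (cmod \<alpha>)\<^sup>2) * backward_shift u \<alpha> = cnj \<alpha> * cnj (v \<alpha>) * u 0"
  defines "\<mu> \<equiv> cnj (v \<alpha>) * u 0"
  shows "T v = (\<lambda>z. \<mu> * v z)" "Tadj v = (\<lambda>z. cnj \<mu> * v z)"
proof -
  define r where "r = complex_of_real (1 - (cmod \<alpha>)\<^sup>2)"
  have r: "r = 1 - \<alpha> * cnj \<alpha>" "cnj r = r"
    by (simp_all add: r_def flip: complex_norm_square)
  have vk: "v = (\<lambda>z. (r * v \<alpha>) * kernel_fun \<alpha> z)" using ker by (simp add: r_def)
  have v0: "v 0 = r * v \<alpha>" using fun_cong[OF vk, of 0] by (simp add: kernel_fun_def)
  have eig: "backward_shift v = (\<lambda>z. cnj \<alpha> * v z)" by (rule backward_shift_kernel_fun[OF v \<alpha> vk])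
  have in_v: "H2_inner f v = r * cnj (v \<alpha>) * f \<alpha>" if "f \<in> H2" for f
    using inner_kernel_fun[OF that v \<alpha> vk] r by simp
  have cond': "1 + cnj (v \<alpha>) * r * \<kappa> * v \<alpha> = cnj \<alpha> * \<mu>"
    using cond by (simp add: r_def backward_u \<mu>_def mult.assoc)
  show "T v = (\<lambda>z. \<mu> * v z)"
  proof
    fix z show "T v z = \<mu> * v z"
    proof (cases "z \<in> ball 0 1")
      case True
      have "v z = r * v \<alpha> + z * (cnj \<alpha> * v z)" "u z = u 0 + z * (\<kappa> * v z)"
        using backward_shift_decomp[OF v True] backward_shift_decomp[OF u True]
        by (simp_all add: eig v0 backward_u)
      \<comment> \<open>After substituting for \<open>u z\<close>, the terms with
        \<open>z * v z\<close> have total coefficient \<open>cnj \<alpha> * \<mu>\<close> by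
        \<open>cond'\<close>, and the rest is \<open>\<mu> * r * v \<alpha>\<close>; together they
        are \<open>\<mu>\<close> times the decomposition of \<open>v z\<close>.\<close>
      thus ?thesis unfolding T_eq shift_def in_v[OF v]
        using cond' unfolding \<mu>_def by algebra
    qed (simp add: H2_outside[OF v] H2_outside[OF T_H2[OF v]])
  qed
  have "u \<alpha> = u 0 + \<alpha> * (\<kappa> * v \<alpha>)"
    using backward_shift_decomp[OF u \<alpha>] by (simp add: backward_u)
  \<comment> \<open>By \<open>cond'\<close>, \<open>H2_inner u v\<close> is
    \<open>r * \<mu> + \<alpha> * (cnj \<alpha> * \<mu> - 1)\<close>, and
    \<open>r + \<alpha> * cnj \<alpha> = 1\<close>.\<close>
  hence "\<alpha> + H2_inner u v = \<mu>"
    using cond' r(1) unfolding in_v[OF u] \<mu>_def by algebra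
  hence "cnj \<mu> = cnj \<alpha> + H2_inner v u"
    using inner_cnj[OF u v] by auto
  thus "Tadj v = (\<lambda>z. cnj \<mu> * v z)"
    by (simp add: Tadj_def eig algebra_simps)
qed

end

theorem corollary1p5:
  fixes u v :: "complex \<Rightarrow> complex" and T :: H2_op
  assumes "u \<in> H2" and "v \<in> H2"
    and "u \<noteq> (\<lambda>_. 0)" and "v \<noteq> (\<lambda>_. 0)"
    and "lin_dep v (H2_adjoint shift u)"
    and T: "T = (\<lambda>f z. shift f z + rank_one u v f z)"
    and "\<not> H2_isometry T"
  shows "quasinormal T \<longleftrightarrow>
    (\<exists>\<alpha>\<in>ball 0 1.
       v = (\<lambda>z. (1 - (cmod \<alpha>)\<^sup>2) * v \<alpha> * kernel_fun \<alpha> z) \<and>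
       1 + cnj (v \<alpha>) * (1 - (cmod \<alpha>)\<^sup>2) * H2_adjoint shift u \<alpha> = cnj \<alpha> * cnj (v \<alpha>) * u 0)"
proof -
  obtain a b where ab: "a \<noteq> 0 \<or> b \<noteq> 0" "\<And>z. a * v z + b * backward_shift u z = 0"
    using assms(5) unfolding lin_dep_def adjoint_shift[OF assms(1)] by blast
  \<comment> \<open>If \<open>b\<close> were 0, then \<open>a\<close> would be nonzero and
    \<open>v\<close> would vanish. So the dependence can be solved for the backward shift of
    \<open>u\<close>.\<close>
  have "b \<noteq> 0" using ab assms(4) by auto
  hence "backward_shift u = (\<lambda>z. (- a / b) * v z)"
    using ab(2) by (auto simp: fun_eq_iff field_simps eq_neg_iff_add_eq_0 add.commute)
  then interpret dependent_rank_one_perturbation u v T "- a / b"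
    by unfold_locales (use assms in auto)
  have "defect \<noteq> 0" using isometry_if_defect_0 assms(7) by blast
  note quasinormal_iff = quasinormal_iff_eigenvector[OF this]
  show ?thesis (is "_ \<longleftrightarrow> (\<exists>\<alpha>\<in>_. ?P \<alpha>)")
  proof
    assume "quasinormal T"
    then obtain \<mu> where "T v = (\<lambda>z. \<mu> * v z)" "Tadj v = (\<lambda>z. cnj \<mu> * v z)"
      unfolding quasinormal_iff by blast
    then obtain \<alpha> where "\<alpha> \<in> ball 0 1" "?P \<alpha>"
      by (rule kernel_if_eigenvector) (intro that conjI, simp_all only: adjoint_shift[OF assms(1)])
    thus "\<exists>\<alpha>\<in>ball 0 1. ?P \<alpha>" by (rule bexI[rotated])
  next
    assume "\<exists>\<alpha>\<in>ball 0 1. ?P \<alpha>"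
    then obtain \<alpha> where \<alpha>: "\<alpha> \<in> ball 0 1" "?P \<alpha>" by (rule bexE)
    note eigenvector_if_kernel[OF \<alpha>(1) conjunct1[OF \<alpha>(2)]
        conjunct2[OF \<alpha>(2), unfolded adjoint_shift[OF assms(1)]]]
    thus "quasinormal T" unfolding quasinormal_iff by (intro exI conjI)
  qed
qed

end
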